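(* Assume $N_1\ge N_2$ and $N_1\ge N_3$. Then for all fixed $n_1,n_3\in\mathbb{Z}^2$, with $S(n_1,n_3)$ the set defined in the context, $$\#S(n_1,n_3)\lesssim\begin{cases}N_2^{2/3},&\text{if }N_1\sim N_3\gg N_2,\\[2pt]\max\left(\dfrac{N_2}{N_1^{1/3}},1\right),&\text{otherwise},\end{cases}$$ with implicit constants independent of $\mu,N_1,N_2,N_3,n_1,n_3$.
   Context: Fix a real number $\gamma\in(1,2)$. For $n,m\in\mathbb{Z}^2$ let $\langle n,m\rangle=n_1m_1+\gamma n_2m_2$ (coordinates) and $|n|=\sqrt{\langle n,n\rangle}$. Fix a constant $K\ge1$, numbers $N_1,N_2,N_3\ge1$ and $\mu\in\mathbb{R}$ with $|\mu|\le K\max(N_1,N_2,N_3)$. Let $$S=\{(n_1,n_2,n_3)\in(\mathbb{Z}^2)^3:\ |n_i|\sim N_i\ (i=1,2,3),\ n_2\ne n_1,\ n_2\neq n_3,\ \langle n_2-n_1,n_2-n_3\rangle=\mu+O(1)\},$$ where $|n_i|\sim N_i$ means $N_i/K\le|n_i|\le KN_i$ and $a=\mu+O(1)$ means $|a-\mu|\le K$. For fixed $n_1,n_3$ let $S(n_1,n_3)=\{n_2:(n_1,n_2,n_3)\in S\}$. In the case distinction, for the parameters satisfying $N_1\ge N_2,N_3$: "$N_1\sim N_3\gg N_2$" means $N_1\le LN_3$ and $N_1>LN_2$, where $L$ is a fixed constant, sufficiently large depending on $K$. Implicit constants in $\lesssim$ may depend on $K$ and $L$. *)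

theory Defs
  imports Complex_Main "HOL-Library.Product_Plus"
begin

definition tinner :: "real \<Rightarrow> int \<times> int \<Rightarrow> int \<times> int \<Rightarrow> real" where
  "tinner \<gamma> n m = of_int (fst n) * of_int (fst m) + \<gamma> * of_int (snd n) * of_int (snd m)"

definition tnorm :: "real \<Rightarrow> int \<times> int \<Rightarrow> real" where
  "tnorm \<gamma> n = sqrt (tinner \<gamma> n n)"

text \<open>One constant \<open>K\<close> serves both as the comparability constant in \<open>x \<sim> N\<close> and as the
  bound for \<open>O(1)\<close> in \<open>\<langle>n2 - n1, n2 - n3\<rangle> = \<mu> + O(1)\<close>.\<close>

definition comparable :: "real \<Rightarrow> real \<Rightarrow> real \<Rightarrow> bool" where
  "comparable K x N \<longleftrightarrow> N / K \<le> x \<and> x \<le> K * N"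

definition resonant_set ::
  "real \<Rightarrow> real \<Rightarrow> real \<Rightarrow> real \<Rightarrow> real \<Rightarrow> real \<Rightarrow> ((int \<times> int) \<times> (int \<times> int) \<times> (int \<times> int)) set"
where
  "resonant_set \<gamma> K \<mu> N1 N2 N3 =
     {(n1, n2, n3).
        comparable K (tnorm \<gamma> n1) N1 \<and> comparable K (tnorm \<gamma> n2) N2 \<and> comparable K (tnorm \<gamma> n3) N3 \<and>
        n2 \<noteq> n1 \<and> n2 \<noteq> n3 \<and>
        \<bar>tinner \<gamma> (n2 - n1) (n2 - n3) - \<mu>\<bar> \<le> K}"

definition resonant_fibre ::
  "real \<Rightarrow> real \<Rightarrow> real \<Rightarrow> real \<Rightarrow> real \<Rightarrow> real \<Rightarrow> int \<times> int \<Rightarrow> int \<times> int \<Rightarrow> (int \<times> int) set"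
where
  "resonant_fibre \<gamma> K \<mu> N1 N2 N3 n1 n3 = {n2. (n1, n2, n3) \<in> resonant_set \<gamma> K \<mu> N1 N2 N3}"

end

theory Submission
  imports Defs
begin

text \<open>Completing the square turns \<open>\<langle>n - n1, n - n3\<rangle> = \<mu> + O(1)\<close> into the statement that \<open>n\<close> lies in
  an elliptic annulus: with \<open>c = (n1 + n3) / 2\<close> and \<open>R\<^sup>2 = \<mu> + |n1 - n3|\<^sup>2 / 4\<close> it reads
  \<open>|n - c|\<^sup>2 = R\<^sup>2 + O(1)\<close>, an annulus of radius \<open>R\<close> and thickness about \<open>1 / R\<close>. What has to be
  counted are its lattice points inside the ball \<open>|n| \<le> K * N2\<close>.

  An arc of this annulus of length at most a small multiple of \<open>R powr (1/3)\<close> contains only boundedly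
  many lattice points. A triangle with vertices in an arc of length \<open>D\<close> has area
  \<open>O(D\<^sup>3 / R)\<close>; twice the area of a lattice triangle is an integer, so for small \<open>D\<^sup>3 / R\<close> all lattice
  points of the arc are collinear (\<open>short_arc_triangle_area\<close>). The squared distance to the centre is
  a quadratic polynomial along a line, with leading coefficient at least 1, so three collinear
  points of the annulus cannot be pairwise far apart (\<open>collinear_separated_false\<close>).

  Cutting the annulus into such arcs gives \<open>O(\<rho> / R powr (1/3) + 1)\<close> points in any box of radius
  \<open>\<rho>\<close> (\<open>annulus_counting_bound\<close>). This is used twice: with \<open>\<rho> = K * N2\<close>, and with \<open>\<rho> = 2 * R\<close>, where
  the box contains the whole annulus and the bound is \<open>O(R powr (2/3))\<close>. If \<open>R\<close> is bounded, the
  whole annulus has \<open>O(1)\<close> lattice points, so let \<open>R\<close> be large. The better of the two bounds is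
  always \<open>O(N2 powr (2/3))\<close>: take the second one if \<open>R \<le> N2\<close> and the first one otherwise. If
  \<open>N2\<close> is comparable to \<open>N1\<close>, then \<open>R = O(N1)\<close> and the second bound is
  \<open>O(N1 powr (2/3)) = O(N2 / N1 powr (1/3))\<close>. If \<open>N3\<close> is much smaller than \<open>N1\<close>, then
  \<open>|n1 - n3|\<close>, and with it \<open>R\<close>, is comparable to \<open>N1\<close> (\<open>shifted_radius_bounds\<close>), and the first
  bound is \<open>O(N2 / N1 powr (1/3) + 1)\<close>.\<close>

section \<open>Short arcs of a thin elliptic annulus\<close>

text \<open>Cramer's rule for the pair of inner products of \<open>p\<close> with \<open>u\<close> and \<open>v\<close>. It shows that
  \<open>det(u, v)\<close> is small when \<open>u\<close> and \<open>v\<close> are short and almost orthogonal to a long \<open>p\<close>.\<close>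

lemma det_identity:
  fixes a b p1 p2 u1 u2 v1 v2 :: real
  shows "(a * p1\<^sup>2 + b * p2\<^sup>2) * (u1 * v2 - u2 * v1) =
    (a * p1 * u1 + b * p2 * u2) * (p1 * v2 - p2 * v1) - (a * p1 * v1 + b * p2 * v2) * (p1 * u2 - p2 * u1)"
  by (simp add: algebra_simps power2_eq_square)

text \<open>A short chord of the annulus is almost orthogonal to the radius: expanding the square, twice
  the inner product is the variation of the quadratic form, at most \<open>2 * K\<close>, minus the squared
  length of the chord.\<close>

lemma chord_inner_bound:
  fixes a b p1 p2 u1 u2 B K D :: real
  assumes ab: "1 \<le> a" "a \<le> 2" "1 \<le> b" "b \<le> 2"
    and p: "\<bar>a * p1\<^sup>2 + b * p2\<^sup>2 - B\<bar> \<le> K"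
    and pu: "\<bar>a * (p1 + u1)\<^sup>2 + b * (p2 + u2)\<^sup>2 - B\<bar> \<le> K"
    and u: "\<bar>u1\<bar> \<le> D" "\<bar>u2\<bar> \<le> D"
  shows "\<bar>a * p1 * u1 + b * p2 * u2\<bar> \<le> K + 2 * D\<^sup>2"
proof -
  have u2: "u1\<^sup>2 \<le> D\<^sup>2" "u2\<^sup>2 \<le> D\<^sup>2"
    using u by (auto simp: abs_le_square_iff[symmetric])
  have "a * u1\<^sup>2 \<le> 2 * D\<^sup>2" "b * u2\<^sup>2 \<le> 2 * D\<^sup>2"
    using ab u2 by (auto intro!: mult_mono)
  moreover have "0 \<le> a * u1\<^sup>2" "0 \<le> b * u2\<^sup>2" using ab by auto
  moreover have "a * (p1 + u1)\<^sup>2 + b * (p2 + u2)\<^sup>2 =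
      (a * p1\<^sup>2 + b * p2\<^sup>2) + 2 * (a * p1 * u1 + b * p2 * u2) + (a * u1\<^sup>2 + b * u2\<^sup>2)"
    by (simp add: algebra_simps power2_eq_square)
  moreover have "\<bar>z\<bar> \<le> K + 2 * D\<^sup>2"
    if "\<bar>q - B\<bar> \<le> K" "\<bar>q' - B\<bar> \<le> K" "q' = q + 2 * z + (s + t)" "0 \<le> s" "0 \<le> t"
      "s \<le> 2 * D\<^sup>2" "t \<le> 2 * D\<^sup>2" for q q' z s t :: real
    using that by linarith
  ultimately show ?thesis using p pu by blast
qed

text \<open>With \<open>s = |p|\<close>, of size about \<open>R\<close>, Cramer's rule bounds \<open>s\<^sup>2 * |det(u, v)|\<close> by twice a product of an
  almost vanishing inner product, \<open>O(D\<^sup>2)\<close>, and a determinant of size \<open>O(s * D)\<close>. Hence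
  \<open>det(u, v) = O(D\<^sup>3 / R)\<close>.\<close>

lemma short_arc_triangle_area:
  fixes a b p1 p2 u1 u2 v1 v2 R K D :: real
  assumes ab: "1 \<le> a" "a \<le> 2" "1 \<le> b" "b \<le> 2" and K: "1 \<le> K" and D: "1 \<le> D"
    and R: "24 * K * D ^ 3 < R" "2 * K \<le> R"
    and p: "\<bar>a * p1\<^sup>2 + b * p2\<^sup>2 - R\<^sup>2\<bar> \<le> K"
    and pu: "\<bar>a * (p1 + u1)\<^sup>2 + b * (p2 + u2)\<^sup>2 - R\<^sup>2\<bar> \<le> K"
    and pv: "\<bar>a * (p1 + v1)\<^sup>2 + b * (p2 + v2)\<^sup>2 - R\<^sup>2\<bar> \<le> K"
    and u: "\<bar>u1\<bar> \<le> D" "\<bar>u2\<bar> \<le> D" and v: "\<bar>v1\<bar> \<le> D" "\<bar>v2\<bar> \<le> D"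
  shows "\<bar>u1 * v2 - u2 * v1\<bar> < 1"
proof -
  define s where "s = sqrt (a * p1\<^sup>2 + b * p2\<^sup>2)"
  have q0: "0 \<le> a * p1\<^sup>2 + b * p2\<^sup>2" using ab by simp
  have s2: "s\<^sup>2 = a * p1\<^sup>2 + b * p2\<^sup>2" unfolding s_def using q0 by simp
  have s0: "0 \<le> s" unfolding s_def using q0 by simp
  have Rpos: "2 \<le> R" using R K by linarith
  have "R * 2 \<le> R * R" using Rpos by (intro mult_left_mono) auto
  hence "2 * R \<le> R\<^sup>2" by (simp add: power2_eq_square)
  hence "4 * K \<le> R\<^sup>2" using R(2) by linarith
  hence "(R/2)\<^sup>2 \<le> s\<^sup>2" using p K s2 by (simp add: power_divide)
  hence sR: "R / 2 \<le> s" using s0 by (rule power2_le_imp_le)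
  have ps: "\<bar>p1\<bar> \<le> s" "\<bar>p2\<bar> \<le> s"
  proof -
    have "1 * p1\<^sup>2 \<le> a * p1\<^sup>2" "1 * p2\<^sup>2 \<le> b * p2\<^sup>2" using ab by (intro mult_right_mono; simp)+
    moreover have "0 \<le> a * p1\<^sup>2" "0 \<le> b * p2\<^sup>2" using ab by auto
    ultimately have "p1\<^sup>2 \<le> s\<^sup>2" "p2\<^sup>2 \<le> s\<^sup>2" unfolding s2 by linarith+
    thus "\<bar>p1\<bar> \<le> s" "\<bar>p2\<bar> \<le> s" using s0 abs_le_square_iff[of p1 s] abs_le_square_iff[of p2 s] by auto
  qed
  have cross: "\<bar>p1 * w2 - p2 * w1\<bar> \<le> 2 * s * D" if "\<bar>w1\<bar> \<le> D" "\<bar>w2\<bar> \<le> D" for w1 w2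
  proof -
    have "\<bar>p1 * w2\<bar> \<le> s * D" "\<bar>p2 * w1\<bar> \<le> s * D"
      unfolding abs_mult using ps that s0 by (auto intro!: mult_mono)
    thus ?thesis by linarith
  qed
  have E: "0 \<le> K + 2 * D\<^sup>2" using K by simp
  have "s\<^sup>2 * \<bar>u1 * v2 - u2 * v1\<bar> = \<bar>s\<^sup>2 * (u1 * v2 - u2 * v1)\<bar>" by (simp add: abs_mult)
  also have "\<dots> = \<bar>(a * p1 * u1 + b * p2 * u2) * (p1 * v2 - p2 * v1)
       - (a * p1 * v1 + b * p2 * v2) * (p1 * u2 - p2 * u1)\<bar>"
    unfolding s2 det_identity ..
  also have "\<dots> \<le> \<bar>a * p1 * u1 + b * p2 * u2\<bar> * \<bar>p1 * v2 - p2 * v1\<bar>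
       + \<bar>a * p1 * v1 + b * p2 * v2\<bar> * \<bar>p1 * u2 - p2 * u1\<bar>"
    unfolding abs_mult[symmetric] by (rule abs_triangle_ineq4)
  also have "\<dots> \<le> (K + 2 * D\<^sup>2) * (2 * s * D) + (K + 2 * D\<^sup>2) * (2 * s * D)"
    using chord_inner_bound[OF ab p pu u] chord_inner_bound[OF ab p pv v] cross[OF v] cross[OF u] E
    by (intro add_mono mult_mono) auto
  finally have "s * (s * \<bar>u1 * v2 - u2 * v1\<bar>) \<le> s * (4 * (K + 2 * D\<^sup>2) * D)"
    by (simp add: power2_eq_square algebra_simps)
  moreover have spos: "0 < s" using sR Rpos by linarith
  ultimately have A: "s * \<bar>u1 * v2 - u2 * v1\<bar> \<le> 4 * (K + 2 * D\<^sup>2) * D"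
    using mult_le_cancel_left_pos by blast
  have "K * 1 \<le> K * D\<^sup>2" "1 * D\<^sup>2 \<le> K * D\<^sup>2" using K D by (auto intro!: mult_mono)
  hence "K + 2 * D\<^sup>2 \<le> 3 * K * D\<^sup>2" by linarith
  hence "4 * (K + 2 * D\<^sup>2) * D \<le> 4 * (3 * K * D\<^sup>2) * D" using D by (intro mult_right_mono) auto
  also have "\<dots> = 12 * K * D ^ 3" by (simp add: power2_eq_square power3_eq_cube)
  also have "\<dots> < R / 2" using R by linarith
  finally have "s * \<bar>u1 * v2 - u2 * v1\<bar> < s * 1" using A sR by linarith
  thus ?thesis using spos mult_less_cancel_left_pos by blast
qed

text \<open>Write \<open>v = t * u\<close>, let \<open>q\<close> and \<open>r\<close> be the increments of the quadratic form from \<open>p\<close> to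
  \<open>p + u\<close> and \<open>p + v\<close>, and \<open>w\<close> its value at \<open>u\<close>. In \<open>t * q - r = t * (1 - t) * w\<close> the terms linear in
  \<open>u\<close> cancel, so \<open>|t| * |1 - t| * w\<close> is at most \<open>2 * K * (|t| + 1)\<close>. Multiplied by the length \<open>m\<close> of
  \<open>u\<close>, the left-hand side is at least the product of the three pairwise distances \<open>m\<close>, \<open>|t| * m\<close> and
  \<open>|1 - t| * m\<close>, and the right-hand side at most \<open>4 * K\<close> times the longer of the first two.
  Cancelling that one leaves two distances with product at most \<open>4 * K < g\<^sup>2\<close>.\<close>

lemma collinear_separated_false:
  fixes a b p1 p2 u1 u2 v1 v2 B K g :: real
  assumes ab: "1 \<le> a" "1 \<le> b" and g: "4 * K < g\<^sup>2" "0 < g" and K: "0 \<le> K"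
    and p: "\<bar>a * p1\<^sup>2 + b * p2\<^sup>2 - B\<bar> \<le> K"
    and pu: "\<bar>a * (p1 + u1)\<^sup>2 + b * (p2 + u2)\<^sup>2 - B\<bar> \<le> K"
    and pv: "\<bar>a * (p1 + v1)\<^sup>2 + b * (p2 + v2)\<^sup>2 - B\<bar> \<le> K"
    and det: "u1 * v2 = u2 * v1"
    and u: "g \<le> max \<bar>u1\<bar> \<bar>u2\<bar>" and v: "g \<le> max \<bar>v1\<bar> \<bar>v2\<bar>"
    and uv: "g \<le> max \<bar>u1 - v1\<bar> \<bar>u2 - v2\<bar>"
  shows False
proof -
  obtain t where t: "v1 = t * u1" "v2 = t * u2"
  proof (cases "u1 = 0")
    case True
    hence "u2 \<noteq> 0" using u g by auto
    thus ?thesis using that[of "v2 / u2"] det True by auto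
  next
    case False
    thus ?thesis using that[of "v1 / u1"] det by (auto simp: field_simps)
  qed
  define m where "m = max \<bar>u1\<bar> \<bar>u2\<bar>"
  have m: "g \<le> m" "0 < m" using u g unfolding m_def by auto
  have tm: "g \<le> \<bar>t\<bar> * m"
    using v unfolding t m_def abs_mult by (auto simp: max_mult_distrib_left)
  have "u1 - v1 = (1 - t) * u1" "u2 - v2 = (1 - t) * u2" unfolding t by (simp_all add: algebra_simps)
  hence tm1: "g \<le> \<bar>1 - t\<bar> * m"
    using uv unfolding m_def by (simp add: abs_mult max_mult_distrib_left)
  define w where "w = a * u1\<^sup>2 + b * u2\<^sup>2"
  have mw: "m\<^sup>2 \<le> w"
  proof -
    have "1 * u1\<^sup>2 \<le> a * u1\<^sup>2" "1 * u2\<^sup>2 \<le> b * u2\<^sup>2" using ab by (intro mult_right_mono; simp)+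
    moreover have "m\<^sup>2 = u1\<^sup>2 \<or> m\<^sup>2 = u2\<^sup>2" unfolding m_def max_def by auto
    ultimately show ?thesis unfolding w_def
      using zero_le_power2[of u1] zero_le_power2[of u2] by linarith
  qed
  define q where "q = (a * (p1 + u1)\<^sup>2 + b * (p2 + u2)\<^sup>2) - (a * p1\<^sup>2 + b * p2\<^sup>2)"
  define r where "r = (a * (p1 + v1)\<^sup>2 + b * (p2 + v2)\<^sup>2) - (a * p1\<^sup>2 + b * p2\<^sup>2)"
  have qr: "\<bar>q\<bar> \<le> 2 * K" "\<bar>r\<bar> \<le> 2 * K" unfolding q_def r_def using p pu pv by linarith+
  have id: "t * q - r = t * (1 - t) * w"
    unfolding q_def r_def w_def t by (simp add: algebra_simps power2_eq_square)
  have "\<bar>t\<bar> * \<bar>1 - t\<bar> * m\<^sup>2 \<le> \<bar>t\<bar> * \<bar>1 - t\<bar> * w" using mw by (intro mult_left_mono) auto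
  also have "\<dots> = \<bar>t * q - r\<bar>" unfolding id abs_mult using mw by (simp add: order_trans[OF zero_le_power2 mw])
  also have "\<dots> \<le> \<bar>t\<bar> * \<bar>q\<bar> + \<bar>r\<bar>" by (metis abs_mult abs_triangle_ineq4)
  also have "\<dots> \<le> \<bar>t\<bar> * (2 * K) + 2 * K" using qr by (intro add_mono mult_left_mono) auto
  finally have main: "\<bar>t\<bar> * \<bar>1 - t\<bar> * m\<^sup>2 \<le> (\<bar>t\<bar> + 1) * (2 * K)" by (simp add: algebra_simps)
  \<comment> \<open>Only the shorter one of the separations \<open>m\<close> and \<open>|t| * m\<close> is used: the longer one is spent
    against the factor \<open>|t| + 1\<close>.\<close>
  show False
  proof (cases "\<bar>t\<bar> \<le> 1")
    case True
    have "g * g \<le> (\<bar>t\<bar> * m) * (\<bar>1 - t\<bar> * m)" using tm tm1 g by (intro mult_mono) auto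
    hence "g\<^sup>2 \<le> (\<bar>t\<bar> + 1) * (2 * K)" using main by (simp add: power2_eq_square algebra_simps)
    also have "\<dots> \<le> 2 * (2 * K)" using True K by (intro mult_right_mono) auto
    finally show False using g by simp
  next
    case False
    have "g * g \<le> m * (\<bar>1 - t\<bar> * m)" using m tm1 g by (intro mult_mono) auto
    hence "\<bar>t\<bar> * g\<^sup>2 \<le> \<bar>t\<bar> * (m * (\<bar>1 - t\<bar> * m))"
      by (intro mult_left_mono) (auto simp: power2_eq_square)
    also have "\<dots> \<le> (\<bar>t\<bar> + 1) * (2 * K)" using main by (simp add: power2_eq_square algebra_simps)
    also have "\<dots> \<le> (\<bar>t\<bar> + \<bar>t\<bar>) * (2 * K)" using False K by (intro mult_right_mono) auto
    also have "\<dots> = \<bar>t\<bar> * (4 * K)" by simp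
    finally have "g\<^sup>2 \<le> 4 * K" using False by (simp add: mult_le_cancel_left)
    thus False using g by simp
  qed
qed

text \<open>Two boxes of radius \<open>g\<close>, centred at two separated points of \<open>F\<close>, cover \<open>F\<close>; one box
  suffices if there are no two such points.\<close>

lemma card_no_three_separated:
  fixes F :: "(int \<times> int) set" and g :: nat
  assumes "\<And>x y x' y' x'' y''. (x, y) \<in> F \<Longrightarrow> (x', y') \<in> F \<Longrightarrow> (x'', y'') \<in> F \<Longrightarrow>
      int g \<le> max \<bar>x' - x\<bar> \<bar>y' - y\<bar> \<Longrightarrow> int g \<le> max \<bar>x'' - x\<bar> \<bar>y'' - y\<bar> \<Longrightarrow>
      int g \<le> max \<bar>x' - x''\<bar> \<bar>y' - y''\<bar> \<Longrightarrow> False"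
  shows "finite F \<and> card F \<le> 2 * (2 * g + 1)\<^sup>2"
proof -
  define box where "box = (\<lambda>(x, y). {x - int g..x + int g} \<times> {y - int g..y + int g})"
  have cb: "finite (box z) \<and> card (box z) = (2 * g + 1)\<^sup>2" for z
    by (cases z) (simp add: box_def card_cartesian_product power2_eq_square nat_add_distrib nat_mult_distrib)
  have nb: "int g \<le> max \<bar>x' - x\<bar> \<bar>y' - y\<bar>" if "(x', y') \<notin> box (x, y)" for x y x' y'
    using that by (auto simp: box_def)
  have "\<exists>z z'. F \<subseteq> box z \<union> box z'"
  proof (cases "\<exists>z\<in>F. \<exists>z'\<in>F. z' \<notin> box z")
    case True
    then obtain x y x' y' where z: "(x, y) \<in> F" "(x', y') \<in> F" "(x', y') \<notin> box (x, y)" by auto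
    have "F \<subseteq> box (x, y) \<union> box (x', y')"
    proof
      fix w assume w: "w \<in> F"
      show "w \<in> box (x, y) \<union> box (x', y')"
      proof (rule ccontr)
        assume n: "w \<notin> box (x, y) \<union> box (x', y')"
        obtain x'' y'' where w': "w = (x'', y'')" by (cases w)
        have "int g \<le> max \<bar>x'' - x'\<bar> \<bar>y'' - y'\<bar>" using nb n unfolding w' by blast
        hence "int g \<le> max \<bar>x' - x''\<bar> \<bar>y' - y''\<bar>" by (simp add: abs_minus_commute)
        thus False using assms[OF z(1,2) w[unfolded w'] nb[OF z(3)] nb] n unfolding w' by blast
      qed
    qed
    thus ?thesis by blast
  next
    case False
    thus ?thesis by blast
  qed
  then obtain z z' where F: "F \<subseteq> box z \<union> box z'" by blast
  have fin: "finite (box z \<union> box z')" using cb by blast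
  have "card F \<le> card (box z \<union> box z')" using F fin by (rule card_mono[rotated])
  also have "\<dots> \<le> card (box z) + card (box z')" by (rule card_Un_le)
  also have "\<dots> = 2 * (2 * g + 1)\<^sup>2" using cb by simp
  finally show ?thesis using finite_subset[OF F fin] by blast
qed

definition annulus_points :: "real \<Rightarrow> real \<Rightarrow> real \<Rightarrow> real \<Rightarrow> real \<Rightarrow> real \<Rightarrow> (int \<times> int) set" where
  "annulus_points a b c1 c2 B K =
     {(x, y). \<bar>a * (real_of_int x - c1)\<^sup>2 + b * (real_of_int y - c2)\<^sup>2 - B\<bar> \<le> K}"

text \<open>The determinant of two differences of lattice points is an integer, so being less than 1 in
  absolute value it vanishes. The points of \<open>F\<close> are therefore collinear, no three of them are pairwise
  \<open>g\<close> apart, and the bound is independent of \<open>R\<close>.\<close>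

lemma card_short_arc:
  fixes a b c1 c2 R K D :: real and F :: "(int \<times> int) set"
  assumes ab: "1 \<le> a" "a \<le> 2" "1 \<le> b" "b \<le> 2" and K: "1 \<le> K" and D: "1 \<le> D"
    and R: "24 * K * D ^ 3 < R" "2 * K \<le> R" and g: "4 * K < (real g)\<^sup>2"
    and F: "F \<subseteq> annulus_points a b c1 c2 (R\<^sup>2) K"
    and diam: "\<And>x y x' y'. (x, y) \<in> F \<Longrightarrow> (x', y') \<in> F \<Longrightarrow>
      \<bar>real_of_int x' - real_of_int x\<bar> \<le> D \<and> \<bar>real_of_int y' - real_of_int y\<bar> \<le> D"
  shows "finite F \<and> card F \<le> 2 * (2 * g + 1)\<^sup>2"
proof (rule card_no_three_separated)
  fix x y x' y' x'' y'' :: int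
  assume z: "(x, y) \<in> F" "(x', y') \<in> F" "(x'', y'') \<in> F"
    and s: "int g \<le> max \<bar>x' - x\<bar> \<bar>y' - y\<bar>" "int g \<le> max \<bar>x'' - x\<bar> \<bar>y'' - y\<bar>"
      "int g \<le> max \<bar>x' - x''\<bar> \<bar>y' - y''\<bar>"
  define p1 p2 where "p1 = real_of_int x - c1" and "p2 = real_of_int y - c2"
  define u1 u2 where "u1 = real_of_int x' - real_of_int x" and "u2 = real_of_int y' - real_of_int y"
  define v1 v2 where "v1 = real_of_int x'' - real_of_int x" and "v2 = real_of_int y'' - real_of_int y"
  have e: "p1 + u1 = real_of_int x' - c1" "p2 + u2 = real_of_int y' - c2"
    "p1 + v1 = real_of_int x'' - c1" "p2 + v2 = real_of_int y'' - c2"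
    unfolding p1_def p2_def u1_def u2_def v1_def v2_def by simp_all
  have p: "\<bar>a * p1\<^sup>2 + b * p2\<^sup>2 - R\<^sup>2\<bar> \<le> K"
    using z F unfolding annulus_points_def p1_def p2_def by auto
  have pu: "\<bar>a * (p1 + u1)\<^sup>2 + b * (p2 + u2)\<^sup>2 - R\<^sup>2\<bar> \<le> K"
    and pv: "\<bar>a * (p1 + v1)\<^sup>2 + b * (p2 + v2)\<^sup>2 - R\<^sup>2\<bar> \<le> K"
    using z F unfolding annulus_points_def e by auto
  have u: "\<bar>u1\<bar> \<le> D" "\<bar>u2\<bar> \<le> D" and v: "\<bar>v1\<bar> \<le> D" "\<bar>v2\<bar> \<le> D"
    using diam z unfolding u1_def u2_def v1_def v2_def by blast+
  have "\<bar>u1 * v2 - u2 * v1\<bar> < 1"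
    by (rule short_arc_triangle_area[OF ab K D R p pu pv u v])
  moreover have "u1 * v2 - u2 * v1 = real_of_int ((x' - x) * (y'' - y) - (y' - y) * (x'' - x))"
    unfolding u1_def u2_def v1_def v2_def by simp
  ultimately have "\<bar>(x' - x) * (y'' - y) - (y' - y) * (x'' - x)\<bar> < 1" by linarith
  hence "(x' - x) * (y'' - y) - (y' - y) * (x'' - x) = 0" by linarith
  hence det: "u1 * v2 = u2 * v1"
    using \<open>u1 * v2 - u2 * v1 = _\<close> by simp
  have cast: "real g \<le> max \<bar>r\<bar> \<bar>r'\<bar>" if "int g \<le> max \<bar>i\<bar> \<bar>j\<bar>" "r = real_of_int i" "r' = real_of_int j" for i j r r'
    using that by auto
  show False
  proof (rule collinear_separated_false[OF ab(1,3) g _ _ p pu pv det])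
    show "0 < real g" using g K by (cases g) auto
    show "0 \<le> K" using K by simp
    show "real g \<le> max \<bar>u1\<bar> \<bar>u2\<bar>" by (rule cast[OF s(1)]) (simp_all add: u1_def u2_def)
    show "real g \<le> max \<bar>v1\<bar> \<bar>v2\<bar>" by (rule cast[OF s(2)]) (simp_all add: v1_def v2_def)
    show "real g \<le> max \<bar>u1 - v1\<bar> \<bar>u2 - v2\<bar>"
      by (rule cast[OF s(3)]) (simp_all add: u1_def u2_def v1_def v2_def)
  qed
qed

section \<open>Cutting the annulus into short arcs\<close>

text \<open>Where the first coordinate is the larger one and keeps its sign, the annulus is close to a
  Lipschitz graph over the second coordinate. Indeed \<open>X' - X\<close> is found from
  \<open>a * (X' - X) * (X' + X) = O(K) - b * (Y' - Y) * (Y' + Y)\<close> upon division by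
  \<open>|X' + X| = |X| + |X'|\<close>, which dominates \<open>|Y' + Y|\<close> and is at least \<open>2 * R / 3\<close>.\<close>

lemma dominant_coordinate_difference:
  fixes a b X Y X' Y' R K h :: real
  assumes ab: "1 \<le> a" "a \<le> 2" "1 \<le> b" "b \<le> 2" and K: "1 \<le> K" and R: "6 * K \<le> R"
    and q: "\<bar>a * X\<^sup>2 + b * Y\<^sup>2 - R\<^sup>2\<bar> \<le> K" and q': "\<bar>a * X'\<^sup>2 + b * Y'\<^sup>2 - R\<^sup>2\<bar> \<le> K"
    and dom: "\<bar>Y\<bar> \<le> \<bar>X\<bar>" "\<bar>Y'\<bar> \<le> \<bar>X'\<bar>" and sgn: "0 < X * X'" and h: "\<bar>Y' - Y\<bar> \<le> h"
  shows "\<bar>X' - X\<bar> \<le> 1 + 2 * h"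
proof -
  have low: "R / 3 \<le> \<bar>Z\<bar>" if z: "\<bar>a * Z\<^sup>2 + b * W\<^sup>2 - R\<^sup>2\<bar> \<le> K" "\<bar>W\<bar> \<le> \<bar>Z\<bar>" for Z W
  proof -
    have "W\<^sup>2 \<le> Z\<^sup>2" using z abs_le_square_iff by blast
    hence "a * Z\<^sup>2 \<le> 2 * Z\<^sup>2" "b * W\<^sup>2 \<le> 2 * Z\<^sup>2" using ab by (auto intro!: mult_mono)
    hence "R\<^sup>2 \<le> 4 * Z\<^sup>2 + K" using z by linarith
    moreover have "6 * K \<le> R\<^sup>2"
    proof -
      have "1 * R \<le> R * R" using R K by (intro mult_right_mono) auto
      thus ?thesis using R by (simp add: power2_eq_square)
    qed
    ultimately have "R\<^sup>2 \<le> 9 * Z\<^sup>2"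
      using zero_le_power2[of Z] by linarith
    hence "(R/3)\<^sup>2 \<le> \<bar>Z\<bar>\<^sup>2" by (simp add: power_divide)
    thus ?thesis by (rule power2_le_imp_le) simp
  qed
  define T where "T = \<bar>X\<bar> + \<bar>X'\<bar>"
  have T: "2 * R / 3 \<le> T" unfolding T_def using low[OF q dom(1)] low[OF q' dom(2)] by linarith
  have T0: "4 * K \<le> T" using T R by linarith
  have TX: "\<bar>X' + X\<bar> = T" unfolding T_def using sgn by (auto simp: zero_less_mult_iff)
  have TY: "\<bar>Y' + Y\<bar> \<le> T" unfolding T_def using dom by linarith
  have h0: "0 \<le> h" using h by linarith
  have id: "a * ((X' - X) * (X' + X)) = (a * X'\<^sup>2 + b * Y'\<^sup>2 - R\<^sup>2) - (a * X\<^sup>2 + b * Y\<^sup>2 - R\<^sup>2)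
       - b * ((Y' - Y) * (Y' + Y))" by (simp add: algebra_simps power2_eq_square)
  have "1 * (\<bar>X' - X\<bar> * T) \<le> a * (\<bar>X' - X\<bar> * T)" using ab T0 K by (intro mult_right_mono) auto
  also have "\<dots> = \<bar>a * ((X' - X) * (X' + X))\<bar>" using ab TX by (simp add: abs_mult)
  also have "\<dots> \<le> 2 * K + \<bar>b * ((Y' - Y) * (Y' + Y))\<bar>" unfolding id using q q' by linarith
  also have "\<bar>b * ((Y' - Y) * (Y' + Y))\<bar> \<le> 2 * (h * T)"
    unfolding abs_mult using ab h TY h0 by (intro mult_mono) auto
  finally have "\<bar>X' - X\<bar> * T \<le> (1 + 2 * h) * T" using T0 K by (simp add: algebra_simps)
  thus ?thesis using T0 K by (simp add: mult_le_cancel_right)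
qed


text \<open>The cells are indexed by the sign of the first coordinate and by an interval of length \<open>l\<close>
  containing the second one, so each cell is an arc of diameter at most \<open>3 * l\<close>. The constant 648 is
  \<open>24 * 3\<^sup>3\<close>, from \<open>short_arc_triangle_area\<close> with \<open>D = 3 * l\<close>.\<close>

lemma card_annulus_dominant_coordinate:
  fixes a b c1 c2 R K e \<rho> l :: real
  assumes ab: "1 \<le> a" "a \<le> 2" "1 \<le> b" "b \<le> 2" and K: "1 \<le> K" and R: "6 * K \<le> R"
    and l: "1 \<le> l" "648 * K * l ^ 3 < R" and g: "4 * K < (real g)\<^sup>2" and \<rho>: "0 \<le> \<rho>"
  shows "finite {(x, y) \<in> annulus_points a b c1 c2 (R\<^sup>2) K.
            \<bar>real_of_int y - c2\<bar> \<le> \<bar>real_of_int x - c1\<bar> \<and> \<bar>real_of_int y - e\<bar> \<le> \<rho>}" (is "finite ?F")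
    and "real (card {(x, y) \<in> annulus_points a b c1 c2 (R\<^sup>2) K.
            \<bar>real_of_int y - c2\<bar> \<le> \<bar>real_of_int x - c1\<bar> \<and> \<bar>real_of_int y - e\<bar> \<le> \<rho>})
         \<le> 4 * (2 * real g + 1)\<^sup>2 * (2 * (\<rho> / l) + 2)"
proof -
  define I where "I = (UNIV :: bool set) \<times> {\<lfloor>- (\<rho> / l)\<rfloor>..\<lfloor>\<rho> / l\<rfloor>}"
  define cell where "cell = (\<lambda>(s, k). {(x, y) \<in> ?F. (c1 < real_of_int x) = s \<and> \<lfloor>(real_of_int y - e) / l\<rfloor> = k})"
  have cell: "finite (cell i) \<and> card (cell i) \<le> 2 * (2 * g + 1)\<^sup>2" for i
  proof (rule card_short_arc[OF ab K])
    show "1 \<le> 3 * l" using l by simp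
    show "24 * K * (3 * l) ^ 3 < R" using l by (simp add: power_mult_distrib)
    show "2 * K \<le> R" using R K by simp
    show "4 * K < (real g)\<^sup>2" by (rule g)
    show "cell i \<subseteq> annulus_points a b c1 c2 (R\<^sup>2) K" unfolding cell_def by (auto split: prod.splits)
  next
    fix x y x' y'
    assume z: "(x, y) \<in> cell i" "(x', y') \<in> cell i"
    have fl: "\<lfloor>(real_of_int y - e) / l\<rfloor> = \<lfloor>(real_of_int y' - e) / l\<rfloor>"
      and sg: "(c1 < real_of_int x) = (c1 < real_of_int x')"
      and q: "\<bar>a * (real_of_int x - c1)\<^sup>2 + b * (real_of_int y - c2)\<^sup>2 - R\<^sup>2\<bar> \<le> K"
        "\<bar>a * (real_of_int x' - c1)\<^sup>2 + b * (real_of_int y' - c2)\<^sup>2 - R\<^sup>2\<bar> \<le> K"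
      and dom: "\<bar>real_of_int y - c2\<bar> \<le> \<bar>real_of_int x - c1\<bar>"
        "\<bar>real_of_int y' - c2\<bar> \<le> \<bar>real_of_int x' - c1\<bar>"
      using z by (auto simp: cell_def annulus_points_def split: prod.splits)
    have "\<bar>(real_of_int y' - e) / l - (real_of_int y - e) / l\<bar> \<le> 1" using fl by linarith
    hence "\<bar>(real_of_int y' - real_of_int y) / l\<bar> \<le> 1" by (simp add: diff_divide_distrib)
    hence dy: "\<bar>real_of_int y' - real_of_int y\<bar> \<le> l" using l by (simp add: abs_divide)
    have "R\<^sup>2 > K"
    proof -
      have "1 * R \<le> R * R" using R K by (intro mult_right_mono) auto
      hence "R \<le> R\<^sup>2" by (simp add: power2_eq_square)
      thus ?thesis using R K by linarith
    qed
    \<comment> \<open>If the dominant coordinate vanished, both would, and the form would be \<open>0\<close> instead of \<open>R\<^sup>2 + O(K)\<close>.\<close>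
    hence "real_of_int x - c1 \<noteq> 0" "real_of_int x' - c1 \<noteq> 0" using q dom by auto
    hence "0 < (real_of_int x - c1) * (real_of_int x' - c1)"
      using sg by (auto simp: zero_less_mult_iff)
    moreover have "\<bar>(real_of_int y' - c2) - (real_of_int y - c2)\<bar> \<le> l" using dy by simp
    ultimately have "\<bar>(real_of_int x' - c1) - (real_of_int x - c1)\<bar> \<le> 1 + 2 * l"
      by (intro dominant_coordinate_difference[OF ab K R q dom]) auto
    thus "\<bar>real_of_int x' - real_of_int x\<bar> \<le> 3 * l \<and> \<bar>real_of_int y' - real_of_int y\<bar> \<le> 3 * l"
      using dy l by auto
  qed
  have sub: "?F \<subseteq> (\<Union>i\<in>I. cell i)"
  proof
    fix z assume z: "z \<in> ?F"
    obtain x y where xy: "z = (x, y)" by (cases z)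
    have "\<bar>real_of_int y - e\<bar> \<le> \<rho>" using z xy by auto
    hence "\<bar>(real_of_int y - e) / l\<bar> \<le> \<rho> / l" using l by (simp add: abs_divide divide_right_mono)
    hence "- (\<rho> / l) \<le> (real_of_int y - e) / l" "(real_of_int y - e) / l \<le> \<rho> / l" by linarith+
    hence "(c1 < real_of_int x, \<lfloor>(real_of_int y - e) / l\<rfloor>) \<in> I" unfolding I_def
      by (auto intro: floor_mono)
    moreover have "z \<in> cell (c1 < real_of_int x, \<lfloor>(real_of_int y - e) / l\<rfloor>)"
      using z unfolding xy cell_def by simp
    ultimately show "z \<in> (\<Union>i\<in>I. cell i)" by blast
  qed
  have finI: "finite I" unfolding I_def by simp
  have finU: "finite (\<Union>i\<in>I. cell i)" using finI cell by blast
  show "finite ?F" using sub finU by (rule finite_subset)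
  have cI: "real (card I) \<le> 2 * (2 * (\<rho> / l) + 2)"
  proof -
    have "0 \<le> \<rho> / l" using \<rho> l by simp
    hence "0 \<le> \<lfloor>\<rho> / l\<rfloor> - \<lfloor>- (\<rho> / l)\<rfloor> + 1" by linarith
    hence "real (card I) = 2 * real_of_int (\<lfloor>\<rho> / l\<rfloor> - \<lfloor>- (\<rho> / l)\<rfloor> + 1)"
      unfolding I_def by (simp add: card_cartesian_product)
    also have "\<dots> \<le> 2 * (2 * (\<rho> / l) + 2)"
    proof -
      have "real_of_int (\<lfloor>q\<rfloor> - \<lfloor>- q\<rfloor> + 1) \<le> 2 * q + 2" for q :: real by linarith
      from this[of "\<rho> / l"] show ?thesis by simp
    qed
    finally show ?thesis .
  qed
  have "card ?F \<le> card (\<Union>i\<in>I. cell i)" using finU sub by (rule card_mono)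
  also have "\<dots> \<le> (\<Sum>i\<in>I. card (cell i))" using finI by (rule card_UN_le)
  also have "\<dots> \<le> (\<Sum>i\<in>I. 2 * (2 * g + 1)\<^sup>2)" using cell by (intro sum_mono) blast
  also have "\<dots> = card I * (2 * (2 * g + 1)\<^sup>2)" by simp
  finally have "real (card ?F) \<le> real (card I * (2 * (2 * g + 1)\<^sup>2))" by (rule of_nat_mono)
  also have "\<dots> = real (card I) * (2 * (2 * real g + 1)\<^sup>2)" by simp
  also have "\<dots> \<le> (2 * (2 * (\<rho> / l) + 2)) * (2 * (2 * real g + 1)\<^sup>2)"
    using cI by (rule mult_right_mono) simp
  finally show "real (card ?F) \<le> 4 * (2 * real g + 1)\<^sup>2 * (2 * (\<rho> / l) + 2)"
    by (simp add: algebra_simps)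
qed

text \<open>Exchanging the coordinates exchanges \<open>a\<close> and \<open>b\<close> and maps the part of the annulus where the
  second coordinate dominates to one where the first does. This symmetry is the reason for
  allowing two general weights instead of \<open>1\<close> and \<open>\<gamma>\<close>.\<close>

lemma card_annulus_in_box:
  fixes a b c1 c2 R K e1 e2 \<rho> l :: real
  assumes ab: "1 \<le> a" "a \<le> 2" "1 \<le> b" "b \<le> 2" and K: "1 \<le> K" and R: "6 * K \<le> R"
    and l: "1 \<le> l" "648 * K * l ^ 3 < R" and g: "4 * K < (real g)\<^sup>2" and \<rho>: "0 \<le> \<rho>"
    and F: "F \<subseteq> annulus_points a b c1 c2 (R\<^sup>2) K"
    and box: "\<And>x y. (x, y) \<in> F \<Longrightarrow> \<bar>real_of_int x - e1\<bar> \<le> \<rho> \<and> \<bar>real_of_int y - e2\<bar> \<le> \<rho>"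
  shows "finite F" and "real (card F) \<le> 16 * (2 * real g + 1)\<^sup>2 * (\<rho> / l + 1)"
proof -
  define P where "P = {(x, y) \<in> annulus_points a b c1 c2 (R\<^sup>2) K.
            \<bar>real_of_int y - c2\<bar> \<le> \<bar>real_of_int x - c1\<bar> \<and> \<bar>real_of_int y - e2\<bar> \<le> \<rho>}"
  define Q where "Q = {(x, y) \<in> annulus_points b a c2 c1 (R\<^sup>2) K.
            \<bar>real_of_int y - c1\<bar> \<le> \<bar>real_of_int x - c2\<bar> \<and> \<bar>real_of_int y - e1\<bar> \<le> \<rho>}"
  have P: "finite P" "real (card P) \<le> 4 * (2 * real g + 1)\<^sup>2 * (2 * (\<rho> / l) + 2)"
    unfolding P_def by (rule card_annulus_dominant_coordinate[OF ab K R l g \<rho>])+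
  have Q: "finite Q" "real (card Q) \<le> 4 * (2 * real g + 1)\<^sup>2 * (2 * (\<rho> / l) + 2)"
    unfolding Q_def by (rule card_annulus_dominant_coordinate[OF ab(3,4,1,2) K R l g \<rho>])+
  have sub: "F \<subseteq> P \<union> prod.swap ` Q"
  proof
    fix z assume z: "z \<in> F"
    obtain x y where xy: "z = (x, y)" by (cases z)
    have an: "(x, y) \<in> annulus_points a b c1 c2 (R\<^sup>2) K" using z xy F by blast
    hence an': "(y, x) \<in> annulus_points b a c2 c1 (R\<^sup>2) K" unfolding annulus_points_def by (simp add: add.commute)
    have bx: "\<bar>real_of_int x - e1\<bar> \<le> \<rho>" "\<bar>real_of_int y - e2\<bar> \<le> \<rho>" using box z xy by blast+
    show "z \<in> P \<union> prod.swap ` Q"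
    proof (cases "\<bar>real_of_int y - c2\<bar> \<le> \<bar>real_of_int x - c1\<bar>")
      case True
      hence "z \<in> P" using an bx unfolding P_def xy by simp
      thus ?thesis by blast
    next
      case False
      hence "(y, x) \<in> Q" using an' bx unfolding Q_def by simp
      thus ?thesis unfolding xy by (metis UnI2 image_eqI swap_simp)
    qed
  qed
  have fin: "finite (P \<union> prod.swap ` Q)" using P Q by simp
  show "finite F" using sub fin by (rule finite_subset)
  have "card F \<le> card (P \<union> prod.swap ` Q)" using fin sub by (rule card_mono)
  also have "\<dots> \<le> card P + card (prod.swap ` Q)" by (rule card_Un_le)
  also have "\<dots> \<le> card P + card Q" using Q card_image_le by simp
  finally have "real (card F) \<le> real (card P) + real (card Q)" by linarith
  also have "\<dots> \<le> 16 * (2 * real g + 1)\<^sup>2 * (\<rho> / l + 1)"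
    using add_mono[OF P(2) Q(2)] by (simp add: algebra_simps)
  finally show "real (card F) \<le> 16 * (2 * real g + 1)\<^sup>2 * (\<rho> / l + 1)" .
qed


lemma card_box:
  fixes c1 c2 r :: real
  assumes r: "0 \<le> r"
    and box: "\<And>x y. (x, y) \<in> F \<Longrightarrow> \<bar>real_of_int x - c1\<bar> \<le> r \<and> \<bar>real_of_int y - c2\<bar> \<le> r"
  shows "finite F" and "real (card F) \<le> (2 * r + 1)\<^sup>2"
proof -
  define I where "I = (\<lambda>c. {\<lceil>c - r\<rceil>..\<lfloor>c + r\<rfloor>})"
  have cI: "real (card (I c)) \<le> 2 * r + 1" for c
    unfolding I_def using r by simp linarith
  have sub: "F \<subseteq> I c1 \<times> I c2"
  proof
    fix z assume z: "z \<in> F"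
    obtain x y where xy: "z = (x, y)" by (cases z)
    have "\<bar>real_of_int x - c1\<bar> \<le> r" "\<bar>real_of_int y - c2\<bar> \<le> r" using box z xy by blast+
    thus "z \<in> I c1 \<times> I c2" unfolding xy I_def by (auto simp: ceiling_le_iff le_floor_iff)
  qed
  have fin: "finite (I c1 \<times> I c2)" unfolding I_def by simp
  show "finite F" using sub fin by (rule finite_subset)
  have "real (card F) \<le> real (card (I c1 \<times> I c2))" using card_mono[OF fin sub] by simp
  also have "\<dots> = real (card (I c1)) * real (card (I c2))" by (simp add: card_cartesian_product)
  also have "\<dots> \<le> (2 * r + 1) * (2 * r + 1)" using cI r by (intro mult_mono) auto
  finally show "real (card F) \<le> (2 * r + 1)\<^sup>2" by (simp add: power2_eq_square)
qed

lemma annulus_coordinate_bound: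
  fixes a b B K r X Y :: real
  assumes "1 \<le> a" "1 \<le> b" "\<bar>a * X\<^sup>2 + b * Y\<^sup>2 - B\<bar> \<le> K" "B + K \<le> r\<^sup>2" "0 \<le> r"
  shows "\<bar>X\<bar> \<le> r" and "\<bar>Y\<bar> \<le> r"
proof -
  have "1 * X\<^sup>2 \<le> a * X\<^sup>2" "1 * Y\<^sup>2 \<le> b * Y\<^sup>2" using assms by (intro mult_right_mono; simp)+
  hence "X\<^sup>2 \<le> r\<^sup>2" "Y\<^sup>2 \<le> r\<^sup>2"
    using assms(3,4) zero_le_power2[of X] zero_le_power2[of Y] by linarith+
  thus "\<bar>X\<bar> \<le> r" "\<bar>Y\<bar> \<le> r" using assms(5) abs_le_square_iff[of X r] abs_le_square_iff[of Y r] by auto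
qed

text \<open>The longest admissible arcs, up to a constant: \<open>l ^ 3 = R / (1000 * K)\<close>, where 1000 could be any
  number above 648. For \<open>R \<ge> 1000 * K\<close> they have length at least 1.\<close>

lemma annulus_counting_bound:
  fixes K :: real
  assumes K: "1 \<le> K"
  obtains C where "1 \<le> C"
    and "\<And>a b c1 c2 R e1 e2 \<rho> F. \<lbrakk>1 \<le> a; a \<le> 2; 1 \<le> b; b \<le> 2; 1000 * K \<le> R; 0 \<le> \<rho>;
        F \<subseteq> annulus_points a b c1 c2 (R\<^sup>2) K;
        \<And>x y. (x, y) \<in> F \<Longrightarrow> \<bar>real_of_int x - e1\<bar> \<le> \<rho> \<and> \<bar>real_of_int y - e2\<bar> \<le> \<rho>\<rbrakk>
      \<Longrightarrow> finite F \<and> real (card F) \<le> C * (\<rho> / R powr (1/3) + 1)"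
proof -
  obtain g :: nat where g: "4 * K < real g" using reals_Archimedean2 by blast
  have "real g * 1 \<le> real g * real g" using g K by (intro mult_left_mono) auto
  hence g2: "4 * K < (real g)\<^sup>2" using g by (simp add: power2_eq_square)
  define h where "h = (1000 * K) powr (1/3)"
  have h: "1 \<le> h" unfolding h_def using K by (intro ge_one_powr_ge_zero) auto
  define M where "M = 16 * (2 * real g + 1)\<^sup>2"
  have M: "1 \<le> M" unfolding M_def using one_le_power[of "2 * real g + 1" 2] by linarith
  have "finite F \<and> real (card F) \<le> (M * h) * (\<rho> / R powr (1/3) + 1)"
    if ab: "1 \<le> a" "a \<le> 2" "1 \<le> b" "b \<le> 2" and R: "1000 * K \<le> R" and \<rho>: "0 \<le> \<rho>"
      and F: "F \<subseteq> annulus_points a b c1 c2 (R\<^sup>2) K"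
      and box: "\<And>x y. (x, y) \<in> F \<Longrightarrow> \<bar>real_of_int x - e1\<bar> \<le> \<rho> \<and> \<bar>real_of_int y - e2\<bar> \<le> \<rho>"
    for a b c1 c2 R e1 e2 \<rho> F
  proof -
    define l where "l = R powr (1/3) / h"
    have lR: "l = (R / (1000 * K)) powr (1/3)" unfolding l_def h_def using R K by (simp add: powr_divide)
    have q: "1 \<le> R / (1000 * K)" using R K by simp
    have l1: "1 \<le> l" unfolding lR using q by (intro ge_one_powr_ge_zero) auto
    have "l ^ 3 = l powr 3" using l1 by simp
    also have "\<dots> = R / (1000 * K)" unfolding lR powr_powr using q K R by simp
    finally have "648 * K * l ^ 3 = 648 / 1000 * R" using K by simp
    moreover have "0 < R" using R K by linarith
    ultimately have l3: "648 * K * l ^ 3 < R" by simp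
    have R6: "6 * K \<le> R" using R K by linarith
    note cnt = card_annulus_in_box[OF ab K R6 l1 l3 g2 \<rho> F box]
    have "real (card F) \<le> M * (\<rho> / l + 1)" using cnt(2) unfolding M_def by blast
    also have "\<rho> / l + 1 \<le> h * (\<rho> / R powr (1/3) + 1)"
      unfolding l_def using h by (simp add: algebra_simps)
    finally have "real (card F) \<le> M * (h * (\<rho> / R powr (1/3) + 1))" using M by simp
    thus ?thesis using cnt(1) by (simp add: mult.assoc)
  qed
  note bound = this
  have "1 \<le> M * h" using mult_mono[OF M h] M by simp
  thus ?thesis by (rule that[OF _ bound])
qed

section \<open>The resonance condition as an annulus\<close>

lemma tinner_completed_square:
  fixes n n1 n3 :: "int \<times> int"
  shows "tinner \<gamma> (n - n1) (n - n3) =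
      1 * (real_of_int (fst n) - (real_of_int (fst n1) + real_of_int (fst n3)) / 2)\<^sup>2
      + \<gamma> * (real_of_int (snd n) - (real_of_int (snd n1) + real_of_int (snd n3)) / 2)\<^sup>2
      - tinner \<gamma> (n1 - n3) (n1 - n3) / 4"
  by (simp add: tinner_def fst_diff snd_diff power2_eq_square field_simps)

lemma tinner_add_le:
  fixes n m :: "int \<times> int"
  assumes "0 \<le> \<gamma>"
  shows "tinner \<gamma> (n + m) (n + m) \<le> 2 * tinner \<gamma> n n + 2 * tinner \<gamma> m m"
proof -
  have "2 * tinner \<gamma> n n + 2 * tinner \<gamma> m m - tinner \<gamma> (n + m) (n + m) =
      (real_of_int (fst n) - fst m)\<^sup>2 + \<gamma> * (real_of_int (snd n) - snd m)\<^sup>2"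
    by (simp add: tinner_def fst_add snd_add power2_eq_square algebra_simps)
  also have "\<dots> \<ge> 0" using assms by simp
  finally show ?thesis by simp
qed

lemma tinner_nonneg: "0 \<le> \<gamma> \<Longrightarrow> 0 \<le> tinner \<gamma> n n"
  unfolding tinner_def by (simp add: mult.assoc)

lemma comparable_tnorm_squared:
  assumes "0 \<le> \<gamma>" "1 \<le> K" "1 \<le> N" "comparable K (tnorm \<gamma> n) N"
  shows "(N / K)\<^sup>2 \<le> tinner \<gamma> n n" and "tinner \<gamma> n n \<le> (K * N)\<^sup>2"
proof -
  have s: "(tnorm \<gamma> n)\<^sup>2 = tinner \<gamma> n n" "0 \<le> tnorm \<gamma> n"
    unfolding tnorm_def using tinner_nonneg[OF assms(1)] by auto
  show "(N / K)\<^sup>2 \<le> tinner \<gamma> n n"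
    using assms unfolding s(1)[symmetric] comparable_def by (intro power_mono) auto
  show "tinner \<gamma> n n \<le> (K * N)\<^sup>2"
    using assms s(2) unfolding s(1)[symmetric] comparable_def by (intro power_mono) auto
qed

text \<open>Here \<open>B\<close> is the squared radius of the annulus. The lower bound needs \<open>N3\<close> small against
  \<open>N1\<close>, so that \<open>|n1 - n3|\<close> is comparable to \<open>N1\<close>, and \<open>N1\<close> large, so that the quadratic term
  absorbs \<open>\<mu>\<close>, which can be as negative as \<open>- K * N1\<close>. The first condition determines how large
  the constant \<open>L\<close> of the case distinction has to be.\<close>

lemma shifted_radius_bounds:
  fixes n1 n3 :: "int \<times> int"
  assumes \<gamma>: "0 \<le> \<gamma>" and K: "1 \<le> K" and N: "1 \<le> N1" "1 \<le> N3" "N3 \<le> N1"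
    and \<mu>: "\<bar>\<mu>\<bar> \<le> K * N1"
    and c: "comparable K (tnorm \<gamma> n1) N1" "comparable K (tnorm \<gamma> n3) N3"
  defines "B \<equiv> \<mu> + tinner \<gamma> (n1 - n3) (n1 - n3) / 4"
  shows "B \<le> (2 * K * N1)\<^sup>2"
    and "2 * K\<^sup>2 * N3 \<le> N1 \<Longrightarrow> 32 * K ^ 3 \<le> N1 \<Longrightarrow> (N1 / (6 * K))\<^sup>2 \<le> B"
proof -
  note t1 = comparable_tnorm_squared[OF \<gamma> K N(1) c(1)] and t3 = comparable_tnorm_squared[OF \<gamma> K N(2) c(2)]
  have "tinner \<gamma> (n1 + (- n3)) (n1 + (- n3)) \<le> 2 * tinner \<gamma> n1 n1 + 2 * tinner \<gamma> (- n3) (- n3)"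
    by (rule tinner_add_le[OF \<gamma>])
  moreover have "tinner \<gamma> (- n3) (- n3) = tinner \<gamma> n3 n3" by (simp add: tinner_def)
  moreover have "(K * N3)\<^sup>2 \<le> (K * N1)\<^sup>2" using N K by (intro power_mono mult_left_mono) auto
  ultimately have up: "tinner \<gamma> (n1 - n3) (n1 - n3) \<le> 4 * (K * N1)\<^sup>2" using t1 t3 by simp
  have KN: "1 \<le> K * N1" using mult_mono[OF K N(1)] K by simp
  hence "K * N1 * 1 \<le> K * N1 * (K * N1)" by (intro mult_left_mono) auto
  hence "K * N1 \<le> (K * N1)\<^sup>2" by (simp add: power2_eq_square)
  hence "B \<le> 2 * (K * N1)\<^sup>2" unfolding B_def using up \<mu> by linarith
  also have "\<dots> \<le> 4 * (K * N1)\<^sup>2" by simp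
  also have "\<dots> = (2 * K * N1)\<^sup>2" by (simp add: power_mult_distrib)
  finally show "B \<le> (2 * K * N1)\<^sup>2" .
  assume far: "2 * K\<^sup>2 * N3 \<le> N1" and big: "32 * K ^ 3 \<le> N1"
  have "tinner \<gamma> ((n1 - n3) + n3) ((n1 - n3) + n3) \<le> 2 * tinner \<gamma> (n1 - n3) (n1 - n3) + 2 * tinner \<gamma> n3 n3"
    by (rule tinner_add_le[OF \<gamma>])
  hence low: "tinner \<gamma> n1 n1 \<le> 2 * tinner \<gamma> (n1 - n3) (n1 - n3) + 2 * tinner \<gamma> n3 n3" by simp
  have "K * N3 \<le> N1 / (2 * K)" using far K by (simp add: field_simps power2_eq_square)
  hence "(K * N3)\<^sup>2 \<le> (N1 / (2 * K))\<^sup>2" using K N by (intro power_mono) auto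
  also have "\<dots> = (N1 / K)\<^sup>2 / 4" by (simp add: power_divide power_mult_distrib)
  finally have "(N1 / K)\<^sup>2 / 4 \<le> tinner \<gamma> (n1 - n3) (n1 - n3)" using low t1 t3 by linarith
  moreover have "K * N1 \<le> (N1 / K)\<^sup>2 / 32"
  proof -
    have "32 * K ^ 3 * N1 \<le> N1 * N1" using big N by (intro mult_right_mono) auto
    thus ?thesis using K by (simp add: field_simps power2_eq_square power3_eq_cube)
  qed
  ultimately have "(N1 / K)\<^sup>2 / 32 \<le> B" unfolding B_def using \<mu> by linarith
  moreover have "(N1 / (6 * K))\<^sup>2 = (N1 / K)\<^sup>2 / 36" by (simp add: power_divide power_mult_distrib)
  moreover have "0 \<le> (N1 / K)\<^sup>2" by simp
  ultimately show "(N1 / (6 * K))\<^sup>2 \<le> B" by linarith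
qed

lemma resonant_fibre_subset_annulus:
  "resonant_fibre \<gamma> K \<mu> N1 N2 N3 n1 n3 \<subseteq>
     annulus_points 1 \<gamma>
       ((real_of_int (fst n1) + real_of_int (fst n3)) / 2) ((real_of_int (snd n1) + real_of_int (snd n3)) / 2)
       (\<mu> + tinner \<gamma> (n1 - n3) (n1 - n3) / 4) K"
proof
  fix n assume "n \<in> resonant_fibre \<gamma> K \<mu> N1 N2 N3 n1 n3"
  hence "\<bar>tinner \<gamma> (n - n1) (n - n3) - \<mu>\<bar> \<le> K"
    by (simp add: resonant_fibre_def resonant_set_def)
  thus "n \<in> annulus_points 1 \<gamma>
       ((real_of_int (fst n1) + real_of_int (fst n3)) / 2) ((real_of_int (snd n1) + real_of_int (snd n3)) / 2)
       (\<mu> + tinner \<gamma> (n1 - n3) (n1 - n3) / 4) K"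
    unfolding tinner_completed_square[of \<gamma> n n1 n3] annulus_points_def by (cases n) (simp add: algebra_simps)
qed

section \<open>The fibre bound\<close>

theorem lemma4p4:
  fixes \<gamma> K :: real
  assumes "1 < \<gamma>" and "\<gamma> < 2" and "1 \<le> K"
  shows "\<exists>L0\<ge>1. \<forall>L\<ge>L0. \<exists>C>0.
    \<forall>(N1::real) (N2::real) (N3::real) (\<mu>::real) (n1 :: int \<times> int) (n3 :: int \<times> int).
      N1 \<ge> 1 \<longrightarrow> N2 \<ge> 1 \<longrightarrow> N3 \<ge> 1 \<longrightarrow>
      \<bar>\<mu>\<bar> \<le> K * max N1 (max N2 N3) \<longrightarrow>
      N1 \<ge> N2 \<longrightarrow> N1 \<ge> N3 \<longrightarrow>
      finite (resonant_fibre \<gamma> K \<mu> N1 N2 N3 n1 n3) \<and>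
      real (card (resonant_fibre \<gamma> K \<mu> N1 N2 N3 n1 n3)) \<le>
        C * (if N1 \<le> L * N3 \<and> N1 > L * N2
             then N2 powr (2 / 3)
             else max (N2 / N1 powr (1 / 3)) 1)"
proof -
  note K = \<open>1 \<le> K\<close>
  have \<gamma>: "1 \<le> \<gamma>" "\<gamma> \<le> 2" "0 \<le> \<gamma>" using assms by auto
  obtain A where A: "1 \<le> A" and count: "\<And>a b c1 c2 R e1 e2 \<rho> F. \<lbrakk>1 \<le> a; a \<le> 2; 1 \<le> b; b \<le> 2;
        1000 * K \<le> R; 0 \<le> \<rho>; F \<subseteq> annulus_points a b c1 c2 (R\<^sup>2) K;
        \<And>x y. (x, y) \<in> F \<Longrightarrow> \<bar>real_of_int x - e1\<bar> \<le> \<rho> \<and> \<bar>real_of_int y - e2\<bar> \<le> \<rho>\<rbrakk>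
      \<Longrightarrow> finite F \<and> real (card F) \<le> A * (\<rho> / R powr (1/3) + 1)"
    using annulus_counting_bound[OF K] by metis
  define r where "r = sqrt ((1000 * K)\<^sup>2 + K)"
  have r: "0 \<le> r" "r\<^sup>2 = (1000 * K)\<^sup>2 + K" unfolding r_def using K by auto
  have L0: "1 \<le> 2 * K\<^sup>2" using one_le_power[OF K, of 2] by linarith
  show ?thesis
  proof (rule exI[of _ "2 * K\<^sup>2"], intro conjI L0 allI impI)
    fix L assume L: "2 * K\<^sup>2 \<le> L"
    have L1: "1 \<le> L" using L L0 by linarith
    \<comment> \<open>The first summand pays for bounded radius; the bracket dominates the constants of the
      cases distinguished below for large radius.\<close>
    define C where "C = (2 * r + 1)\<^sup>2 + A * (3 + 2 * K + 6 * K * L + 7 * K\<^sup>2 + 33 * K ^ 4)"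
    have pos: "0 \<le> (2 * r + 1)\<^sup>2" "0 \<le> K * L" "0 \<le> K\<^sup>2" "0 \<le> K ^ 4" using K L1 by auto
    have C0: "(2 * r + 1)\<^sup>2 \<le> C" unfolding C_def using A K pos by simp
    have CA: "A * t \<le> C" if "t \<le> 3 + 2 * K + 6 * K * L + 7 * K\<^sup>2 + 33 * K ^ 4" for t
    proof -
      have "A * t \<le> A * (3 + 2 * K + 6 * K * L + 7 * K\<^sup>2 + 33 * K ^ 4)"
        using A that by (intro mult_left_mono) auto
      thus ?thesis unfolding C_def using pos(1) by linarith
    qed
    have Cpos: "0 < C" using CA[of 1] A K pos by simp
    show "\<exists>C>0. \<forall>(N1::real) (N2::real) (N3::real) (\<mu>::real) (n1 :: int \<times> int) (n3 :: int \<times> int).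
      N1 \<ge> 1 \<longrightarrow> N2 \<ge> 1 \<longrightarrow> N3 \<ge> 1 \<longrightarrow>
      \<bar>\<mu>\<bar> \<le> K * max N1 (max N2 N3) \<longrightarrow>
      N1 \<ge> N2 \<longrightarrow> N1 \<ge> N3 \<longrightarrow>
      finite (resonant_fibre \<gamma> K \<mu> N1 N2 N3 n1 n3) \<and>
      real (card (resonant_fibre \<gamma> K \<mu> N1 N2 N3 n1 n3)) \<le>
        C * (if N1 \<le> L * N3 \<and> N1 > L * N2
             then N2 powr (2 / 3)
             else max (N2 / N1 powr (1 / 3)) 1)"
    proof (intro exI[of _ C] conjI[OF Cpos] allI impI)
      fix N1 N2 N3 \<mu> :: real and n1 n3 :: "int \<times> int"
      assume N: "1 \<le> N1" "1 \<le> N2" "1 \<le> N3" "N2 \<le> N1" "N3 \<le> N1"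
        and \<mu>: "\<bar>\<mu>\<bar> \<le> K * max N1 (max N2 N3)"
      have \<mu>': "\<bar>\<mu>\<bar> \<le> K * N1" using \<mu> N by (simp add: max_def split: if_splits)
      define F where "F = resonant_fibre \<gamma> K \<mu> N1 N2 N3 n1 n3"
      define E where "E = (if N1 \<le> L * N3 \<and> N1 > L * N2
             then N2 powr (2 / 3) else max (N2 / N1 powr (1 / 3)) 1)"
      have E1: "1 \<le> E" unfolding E_def using N by (auto intro: ge_one_powr_ge_zero)
      define c1 c2 where "c1 = (real_of_int (fst n1) + real_of_int (fst n3)) / 2"
        and "c2 = (real_of_int (snd n1) + real_of_int (snd n3)) / 2"
      define B where "B = \<mu> + tinner \<gamma> (n1 - n3) (n1 - n3) / 4"
      have FB: "F \<subseteq> annulus_points 1 \<gamma> c1 c2 B K"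
        unfolding F_def c1_def c2_def B_def by (rule resonant_fibre_subset_annulus)
      have box: "\<bar>real_of_int x - c1\<bar> \<le> s \<and> \<bar>real_of_int y - c2\<bar> \<le> s"
        if "(x, y) \<in> F" "B + K \<le> s\<^sup>2" "0 \<le> s" for x y s
        using annulus_coordinate_bound[of 1 \<gamma> "real_of_int x - c1" "real_of_int y - c2" B K s]
          that FB \<gamma> unfolding annulus_points_def by auto
      have "finite F \<and> real (card F) \<le> C * E"
      proof (cases "F = {}")
        case True
        thus ?thesis using Cpos E1 by simp
      next
        case False
        then obtain n where "n \<in> F" by blast
        hence cmp: "comparable K (tnorm \<gamma> n1) N1" "comparable K (tnorm \<gamma> n3) N3"
          unfolding F_def resonant_fibre_def resonant_set_def by auto
        have Bup: "B \<le> (2 * K * N1)\<^sup>2"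
          and Blow: "2 * K\<^sup>2 * N3 \<le> N1 \<Longrightarrow> 32 * K ^ 3 \<le> N1 \<Longrightarrow> (N1 / (6 * K))\<^sup>2 \<le> B"
          using shifted_radius_bounds[OF \<gamma>(3) K N(1,3,5) \<mu>' cmp] unfolding B_def by blast+
        show ?thesis
        proof (cases "B \<le> (1000 * K)\<^sup>2")
          case True
          \<comment> \<open>Bounded radius (\<open>B\<close> may even be negative): the whole annulus lies in a box of radius \<open>r\<close>.\<close>
          have "finite F" "real (card F) \<le> (2 * r + 1)\<^sup>2"
            using card_box[OF r(1), of F c1 c2] box[where s = r] r True by auto
          moreover have "C * 1 \<le> C * E" using Cpos E1 by (intro mult_left_mono) auto
          ultimately show ?thesis using C0 by simp
        next
          case False
          define R where "R = sqrt B"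
          have "0 \<le> B" using False zero_le_power2[of "1000 * K"] by linarith
          hence RB: "R\<^sup>2 = B" "0 \<le> R" unfolding R_def by auto
          have R: "1000 * K \<le> R" using False RB by (intro power2_le_imp_le[of "1000 * K" R]) auto
          have R1: "1 \<le> R" using R K by linarith
          have FR: "F \<subseteq> annulus_points 1 \<gamma> c1 c2 (R\<^sup>2) K" using FB RB by simp
          have third: "t / t powr (1/3) = t powr (2/3)" if "0 < t" for t :: real
            using that powr_diff[of t 1 "1/3"] by simp
          have "\<bar>real_of_int x - 0\<bar> \<le> K * N2 \<and> \<bar>real_of_int y - 0\<bar> \<le> K * N2" if "(x, y) \<in> F" for x y
          proof -
            have "comparable K (tnorm \<gamma> (x, y)) N2"
              using that unfolding F_def resonant_fibre_def resonant_set_def by auto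
            from comparable_tnorm_squared(2)[OF \<gamma>(3) K N(2) this]
            have "1 * (real_of_int x)\<^sup>2 + \<gamma> * (real_of_int y)\<^sup>2 \<le> (K * N2)\<^sup>2"
              by (simp add: tinner_def power2_eq_square mult.assoc)
            moreover have "0 \<le> 1 * (real_of_int x)\<^sup>2 + \<gamma> * (real_of_int y)\<^sup>2" using \<gamma> by simp
            ultimately show ?thesis
              using annulus_coordinate_bound[of 1 \<gamma> "real_of_int x" "real_of_int y" 0 "(K * N2)\<^sup>2" "K * N2"] \<gamma> K N
              by simp
          qed
          from count[OF _ _ \<gamma>(1,2) R _ FR this]
          have fin: "finite F" and local: "real (card F) \<le> A * (K * N2 / R powr (1/3) + 1)"
            using K N by auto
          have "B + K \<le> (2 * R)\<^sup>2"
          proof -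
            have "R * 1 \<le> R * R" using R1 by (intro mult_left_mono) auto
            hence "R \<le> R\<^sup>2" by (simp add: power2_eq_square)
            hence "K \<le> R\<^sup>2" using R K by linarith
            thus ?thesis using RB \<open>0 \<le> B\<close> by (simp add: power_mult_distrib)
          qed
          hence "\<bar>real_of_int x - c1\<bar> \<le> 2 * R \<and> \<bar>real_of_int y - c2\<bar> \<le> 2 * R" if "(x, y) \<in> F" for x y
            using box that RB by simp
          from count[OF _ _ \<gamma>(1,2) R _ FR this] R1
          have "real (card F) \<le> A * (2 * (R / R powr (1/3)) + 1)" by simp
          also have "\<dots> = A * (2 * R powr (2/3) + 1)" using third[of R] R1 by simp
          also have "\<dots> \<le> A * (3 * R powr (2/3))"
            using ge_one_powr_ge_zero[of R "2/3"] R1 A by (intro mult_left_mono) auto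
          finally have global: "real (card F) \<le> A * (3 * R powr (2/3))" .
          have conclude: "real (card F) \<le> C * E"
            if "real (card F) \<le> A * s" "s \<le> t * E" "t \<le> 3 + 2 * K + 6 * K * L + 7 * K\<^sup>2 + 33 * K ^ 4"
            for s t
          proof -
            have "A * s \<le> A * t * E" using mult_left_mono[OF that(2), of A] A by (simp add: mult.assoc)
            also have "\<dots> \<le> C * E" using CA[OF that(3)] E1 by (intro mult_right_mono) auto
            finally show ?thesis using that(1) by linarith
          qed
          have "real (card F) \<le> C * E"
          proof (cases "N1 \<le> L * N3 \<and> N1 > L * N2")
            case True
            hence E: "E = N2 powr (2/3)" unfolding E_def by simp
            show ?thesis
            proof (cases "R \<le> N2")
              case True
              hence "R powr (2/3) \<le> E" unfolding E using R1 by (intro powr_mono2) auto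
              thus ?thesis using K pos by (intro conclude[OF global, where t = "3"]) auto
            next
              case False
              hence "K * N2 / R powr (1/3) \<le> K * N2 / N2 powr (1/3)"
                using N K R1 by (intro divide_left_mono powr_mono2) auto
              also have "\<dots> = K * E" unfolding E using third[of N2] N by (simp flip: times_divide_eq_right)
              finally have "K * N2 / R powr (1/3) + 1 \<le> (K + 1) * E" using E1 by (simp add: algebra_simps)
              thus ?thesis using K pos by (intro conclude[OF local, where t = "K + 1"]) auto
            qed
          next
            case other: False
            hence E: "N2 / N1 powr (1/3) \<le> E" unfolding E_def by auto
            have powK: "t powr s \<le> t" if "1 \<le> t" "s \<le> 1" for t s :: real
              using powr_mono[of s 1 t] that by simp
            show ?thesis
            proof (cases "N1 \<le> L * N2")
              case True
              have "R \<le> 2 * K * N1" using Bup RB K N by (intro power2_le_imp_le[of R "2 * K * N1"]) auto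
              hence "R powr (2/3) \<le> (2 * K * N1) powr (2/3)" using R1 by (intro powr_mono2) auto
              also have "\<dots> = (2 * K) powr (2/3) * N1 powr (2/3)" using K N by (simp add: powr_mult)
              also have "\<dots> \<le> (2 * K) * N1 powr (2/3)"
                using powK[of "2 * K" "2/3"] K by (intro mult_right_mono) auto
              also have "N1 powr (2/3) = N1 / N1 powr (1/3)" using third[of N1] N by simp
              also have "N1 / N1 powr (1/3) \<le> L * N2 / N1 powr (1/3)" using True by (intro divide_right_mono) auto
              also have "\<dots> = L * (N2 / N1 powr (1/3))" by simp
              also have "\<dots> \<le> L * E" using E L1 by (intro mult_left_mono) auto
              finally have "R powr (2/3) \<le> 2 * K * (L * E)" using K by simp
              hence "3 * R powr (2/3) \<le> 6 * K * L * E" by (simp add: mult_ac)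
              thus ?thesis using K pos by (intro conclude[OF global, where t = "6 * K * L"]) auto
            next
              case False
              hence "L * N3 < N1" using other by auto
              moreover have "2 * K\<^sup>2 * N3 \<le> L * N3" using L N by (intro mult_right_mono) auto
              ultimately have far: "2 * K\<^sup>2 * N3 \<le> N1" by linarith
              show ?thesis
              proof (cases "32 * K ^ 3 \<le> N1")
                case True
                \<comment> \<open>The centres \<open>n1\<close> and \<open>n3\<close> are far apart, so \<open>R\<close> is comparable to \<open>N1\<close> and
                  the first bound is the sharp one.\<close>
                have "N1 / (6 * K) \<le> R" using Blow[OF far True] RB by (intro power2_le_imp_le[of "N1 / (6 * K)" R]) auto
                hence "N1 \<le> 6 * K * R" using K by (simp add: field_simps)
                hence "N1 powr (1/3) \<le> (6 * K * R) powr (1/3)" using N by (intro powr_mono2) auto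
                also have "\<dots> = (6 * K) powr (1/3) * R powr (1/3)" using K R1 by (simp add: powr_mult)
                also have "\<dots> \<le> (6 * K) * R powr (1/3)"
                  using powK[of "6 * K" "1/3"] K by (intro mult_right_mono) auto
                finally have "N2 / R powr (1/3) \<le> 6 * K * (N2 / N1 powr (1/3))"
                  using N R1 by (simp add: field_simps)
                also have "\<dots> \<le> 6 * K * E" using E K by (intro mult_left_mono) auto
                finally have "K * (N2 / R powr (1/3)) \<le> K * (6 * K * E)" using K by (intro mult_left_mono) auto
                moreover have "1 \<le> K\<^sup>2 * E" using mult_mono[OF one_le_power[OF K, of 2] E1] by simp
                ultimately have "K * N2 / R powr (1/3) + 1 \<le> 7 * K\<^sup>2 * E"
                  by (simp add: power2_eq_square)
                thus ?thesis using K pos by (intro conclude[OF local, where t = "7 * K\<^sup>2"]) auto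
              next
                case False
                \<comment> \<open>Now \<open>N1\<close>, and with it \<open>N2\<close>, is bounded in terms of \<open>K\<close>.\<close>
                have "K * N2 / R powr (1/3) \<le> K * N2 / 1"
                  using N K ge_one_powr_ge_zero[of R "1/3"] R1 by (intro divide_left_mono) auto
                also have "\<dots> \<le> K * (32 * K ^ 3)" using False N K by simp
                also have "\<dots> = 32 * K ^ 4" by (simp add: power_numeral_reduce)
                finally have "K * N2 / R powr (1/3) + 1 \<le> 33 * K ^ 4" using one_le_power[OF K, of 4] by linarith
                also have "\<dots> \<le> 33 * K ^ 4 * E" using mult_left_mono[OF E1, of "33 * K ^ 4"] pos by simp
                finally show ?thesis using K pos by (intro conclude[OF local, where t = "33 * K ^ 4"]) auto
              qed
            qed
          qed
          thus ?thesis using fin by simp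
        qed
      qed
      thus "finite (resonant_fibre \<gamma> K \<mu> N1 N2 N3 n1 n3) \<and>
        real (card (resonant_fibre \<gamma> K \<mu> N1 N2 N3 n1 n3)) \<le>
        C * (if N1 \<le> L * N3 \<and> N1 > L * N2
             then N2 powr (2 / 3)
             else max (N2 / N1 powr (1 / 3)) 1)"
        unfolding F_def E_def .
    qed
  qed
qed

end
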